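(* Let $X$ be a set. The subspace $2^{X_d}_f\cup\{X\}\subset 2^{X_d}_u$ is the Alexandroff extension of $2^{X_d}_f$.
   Context: For a set $X$, let $X_d$ be $X$ with the discrete topology. $2^{X_d}_u$ denotes the set of all non-empty subsets of $X$ with the upper semifinite topology, i.e. the topology generated by the base of sets $B(U)=\{C\subseteq X: C\neq\emptyset,\ C\subseteq U\}$, $U\subseteq X$. $2^{X_d}_f\subset 2^{X_d}_u$ is the subspace of finite non-empty subsets of $X$, with the subspace topology. The Alexandroff extension (or one-point compactification) of an arbitrary topological space $Z$ is the set $Z^*=Z\cup\{\infty\}$, where $\infty$ is any point not in $Z$, whose open sets are the open sets of $Z$ together with the subsets $U\subseteq Z^*$ such that $Z^*\setminus U$ is a closed and compact subset of $Z$ (compact does not include Hausdorff).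
   Formalization: The set X is assumed infinite: for finite non-empty X the point X already lies in the space of finite non-empty subsets, so nothing is added and the claim fails; for empty X, X is not a point of the hyperspace. *)

theory Defs
  imports "HOL-Analysis.Analysis"
begin

definition hyper_basic :: "'a set \<Rightarrow> 'a set set"
  where "hyper_basic U = {C. C \<noteq> {} \<and> C \<subseteq> U}"

(* Since X carries the discrete topology, U ranges over all subsets of X. *)
definition upper_semifinite :: "'a set \<Rightarrow> 'a set topology"
  where "upper_semifinite X =
    topology (arbitrary union_of (\<lambda>W. \<exists>U\<subseteq>X. W = hyper_basic U))"

definition finite_hyperset :: "'a set \<Rightarrow> 'a set set"
  where "finite_hyperset X = {C. C \<noteq> {} \<and> C \<subseteq> X \<and> finite C}"

definition finite_hyperspace :: "'a set \<Rightarrow> 'a set topology"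
  where "finite_hyperspace X = subtopology (upper_semifinite X) (finite_hyperset X)"

lemma openin_upper_semifinite:
  "openin (upper_semifinite X) = arbitrary union_of (\<lambda>W. \<exists>U\<subseteq>X. W = hyper_basic U)"
proof -
  have "istopology (arbitrary union_of (\<lambda>W. \<exists>U\<subseteq>X. W = hyper_basic U))"
  proof (rule istopology_base)
    fix S T
    assume "\<exists>U\<subseteq>X. S = hyper_basic U" and "\<exists>U\<subseteq>X. T = hyper_basic U"
    then obtain U V where "U \<subseteq> X" "S = hyper_basic U" "V \<subseteq> X" "T = hyper_basic V"
      by blast
    then have "U \<inter> V \<subseteq> X" and "S \<inter> T = hyper_basic (U \<inter> V)"
      by (auto simp: hyper_basic_def)
    then show "\<exists>U\<subseteq>X. S \<inter> T = hyper_basic U"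
      by blast
  qed
  then show ?thesis
    by (simp add: upper_semifinite_def topology_inverse')
qed

lemma topspace_upper_semifinite: "topspace (upper_semifinite X) = {C. C \<noteq> {} \<and> C \<subseteq> X}"
proof -
  have "openin (upper_semifinite X) (hyper_basic X)"
    unfolding openin_upper_semifinite by (rule union_of_inc) (auto simp: arbitrary_def)
  moreover have "W \<subseteq> hyper_basic X" if "openin (upper_semifinite X) W" for W
    using that unfolding openin_upper_semifinite union_of_def hyper_basic_def by blast
  ultimately have "topspace (upper_semifinite X) = hyper_basic X"
    by (simp add: openin_subset subset_antisym)
  then show ?thesis
    by (simp add: hyper_basic_def)
qed

end

theory Submission
  imports Defs
begin

text \<open>
  The upper semifinite topology over a discrete space is the Alexandrov topology of reverse
  inclusion: its open sets are exactly the families closed under passing to non-empty subsets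
  (\<open>openin_upper_semifinite_iff\<close>).

  In \<open>2\<^sub>f \<union> {X}\<close> the point \<open>X\<close> contains every other point, so its only neighbourhood is the
  whole space. In the Alexandroff extension of \<open>2\<^sub>f\<close> the open neighbourhoods of \<open>\<infinity>\<close> are the
  complements of closed compact sets, so the claim amounts to saying that \<open>2\<^sub>f\<close> has no closed
  compact set except the empty one (\<open>closed_compact_finite_hyperspace_empty\<close>). A compact family
  of finite sets has a finite union, since the down-sets of its members cover it; a closed family
  is closed under finite supersets, so a non-empty one has union \<open>X\<close>, which is infinite. Away
  from \<open>X\<close> and \<open>\<infinity>\<close> both spaces carry the topology of \<open>2\<^sub>f\<close>, and \<open>2\<^sub>f\<close> is open in both,
  because no finite set contains \<open>X\<close> (\<open>openin_finite_hyperset_with_top_iff\<close>).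
\<close>

lemma openin_upper_semifinite_iff:
  "openin (upper_semifinite X) W \<longleftrightarrow> W \<subseteq> hyper_basic X \<and> (\<forall>C\<in>W. hyper_basic C \<subseteq> W)"
proof
  assume "openin (upper_semifinite X) W"
  then obtain \<U> where \<U>: "\<And>V. V \<in> \<U> \<Longrightarrow> \<exists>U\<subseteq>X. V = hyper_basic U" and W: "W = \<Union>\<U>"
    unfolding openin_upper_semifinite union_of_def by blast
  show "W \<subseteq> hyper_basic X \<and> (\<forall>C\<in>W. hyper_basic C \<subseteq> W)"
  proof (intro conjI ballI)
    show "W \<subseteq> hyper_basic X"
      using \<U> unfolding W hyper_basic_def by blast
    fix C
    assume "C \<in> W"
    then obtain V where "V \<in> \<U>" "C \<in> V"
      unfolding W by blast
    with \<U> show "hyper_basic C \<subseteq> W"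
      unfolding W by (fastforce simp: hyper_basic_def)
  qed
next
  assume W: "W \<subseteq> hyper_basic X \<and> (\<forall>C\<in>W. hyper_basic C \<subseteq> W)"
  show "openin (upper_semifinite X) W"
    unfolding openin_upper_semifinite union_of_def arbitrary_def
  proof (intro exI conjI)
    show "hyper_basic ` W \<subseteq> {V. \<exists>U\<subseteq>X. V = hyper_basic U}"
      using W by (auto simp: hyper_basic_def)
    show "\<Union>(hyper_basic ` W) = W"
      using W by (auto simp: hyper_basic_def)
  qed simp
qed

text \<open>
  A family closed under subsets within \<open>S\<close> is the trace on \<open>S\<close> of the family of all non-empty
  subsets of its members, so the subspace again has the topology given by the restricted order.
\<close>

lemma openin_subtopology_upper_semifinite_iff:
  assumes "S \<subseteq> hyper_basic X"
  shows "openin (subtopology (upper_semifinite X) S) W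
           \<longleftrightarrow> W \<subseteq> S \<and> (\<forall>C\<in>W. hyper_basic C \<inter> S \<subseteq> W)"
proof
  assume "openin (subtopology (upper_semifinite X) S) W"
  then show "W \<subseteq> S \<and> (\<forall>C\<in>W. hyper_basic C \<inter> S \<subseteq> W)"
    unfolding openin_subtopology openin_upper_semifinite_iff by blast
next
  assume W: "W \<subseteq> S \<and> (\<forall>C\<in>W. hyper_basic C \<inter> S \<subseteq> W)"
  let ?T = "\<Union>(hyper_basic ` W)"
  have "openin (upper_semifinite X) ?T"
    using W assms unfolding openin_upper_semifinite_iff by (fastforce simp: hyper_basic_def)
  moreover have "?T \<inter> S = W"
  proof
    show "?T \<inter> S \<subseteq> W"
      using W by blast
    show "W \<subseteq> ?T \<inter> S"
      using W assms by (auto simp: hyper_basic_def)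
  qed
  ultimately show "openin (subtopology (upper_semifinite X) S) W"
    unfolding openin_subtopology by (intro exI[of _ ?T]) simp
qed

lemma finite_hyperset_subset: "finite_hyperset X \<subseteq> hyper_basic X"
  by (auto simp: finite_hyperset_def hyper_basic_def)

lemma topspace_finite_hyperspace: "topspace (finite_hyperspace X) = finite_hyperset X"
  by (auto simp: finite_hyperspace_def topspace_upper_semifinite finite_hyperset_def)

lemma openin_finite_hyperspace_iff:
  "openin (finite_hyperspace X) W
     \<longleftrightarrow> W \<subseteq> finite_hyperset X \<and> (\<forall>C\<in>W. hyper_basic C \<subseteq> W)"
proof -
  have "hyper_basic C \<subseteq> finite_hyperset X" if "C \<in> finite_hyperset X" for C
    using that by (auto simp: finite_hyperset_def hyper_basic_def intro: finite_subset)
  then show ?thesis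
    unfolding finite_hyperspace_def
      openin_subtopology_upper_semifinite_iff[OF finite_hyperset_subset]
    by blast
qed

lemma closedin_finite_hyperspace_superset:
  assumes "closedin (finite_hyperspace X) K" "C \<in> K" "C \<subseteq> D" "D \<in> finite_hyperset X"
  shows "D \<in> K"
proof (rule ccontr)
  assume "D \<notin> K"
  moreover have "openin (finite_hyperspace X) (finite_hyperset X - K)"
    using assms(1) by (simp add: closedin_def topspace_finite_hyperspace)
  ultimately have "hyper_basic D \<subseteq> finite_hyperset X - K"
    using assms(4) unfolding openin_finite_hyperspace_iff by blast
  moreover have "C \<in> finite_hyperset X"
    using assms(1,2) closedin_subset by (fastforce simp: topspace_finite_hyperspace)
  ultimately show False
    using assms(2,3) by (auto simp: hyper_basic_def finite_hyperset_def)
qed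

text \<open>
  The smallest open set around a finite set \<open>D\<close> consists of subsets of \<open>D\<close>, so finitely many such
  open sets reach only finitely many points of the underlying set.
\<close>

lemma compactin_finite_hyperspace_imp_finite_Union:
  assumes "compactin (finite_hyperspace X) K"
  shows "finite (\<Union>K)"
proof -
  have K: "K \<subseteq> finite_hyperset X"
    using assms compactin_subset_topspace by (fastforce simp: topspace_finite_hyperspace)
  have "\<forall>V\<in>hyper_basic ` K. openin (finite_hyperspace X) V"
    using K unfolding openin_finite_hyperspace_iff
    by (auto simp: hyper_basic_def finite_hyperset_def intro: finite_subset)
  moreover have "K \<subseteq> \<Union>(hyper_basic ` K)"
    using K by (auto simp: hyper_basic_def finite_hyperset_def)
  ultimately obtain \<F> where "finite \<F>" "\<F> \<subseteq> hyper_basic ` K" "K \<subseteq> \<Union>\<F>"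
    using assms unfolding compactin_def by blast
  then obtain L where L: "L \<subseteq> K" "finite L" "K \<subseteq> \<Union>(hyper_basic ` L)"
    by (metis finite_subset_image)
  have "finite (\<Union>L)"
    using L K by (auto simp: finite_hyperset_def)
  moreover have "\<Union>K \<subseteq> \<Union>L"
    using L(3) by (fastforce simp: hyper_basic_def)
  ultimately show ?thesis
    by (rule rev_finite_subset)
qed

text \<open>
  A member \<open>C\<close> of \<open>K\<close> can be enlarged inside \<open>K\<close> by any point of \<open>X\<close>, so \<open>K\<close> covers \<open>X\<close>, while
  compactness keeps its union finite. Consequently \<open>\<infinity>\<close> has no neighbourhood but the whole
  Alexandroff extension.
\<close>

lemma closed_compact_finite_hyperspace_empty:
  assumes "infinite X" "compactin (finite_hyperspace X) K" "closedin (finite_hyperspace X) K"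
  shows "K = {}"
proof (rule ccontr)
  assume "K \<noteq> {}"
  then obtain C where C: "C \<in> K"
    by blast
  then have CX: "C \<in> finite_hyperset X"
    using assms(3) closedin_subset by (fastforce simp: topspace_finite_hyperspace)
  have "insert x C \<in> K" if "x \<in> X" for x
    using closedin_finite_hyperspace_superset[OF assms(3) C] CX that
    by (auto simp: finite_hyperset_def)
  then have "X \<subseteq> \<Union>K"
    by blast
  then show False
    using assms(1) compactin_finite_hyperspace_imp_finite_Union[OF assms(2)]
    by (simp add: finite_subset)
qed

text \<open>
  The point \<open>X\<close> contains every other point and is contained in none: a neighbourhood of \<open>X\<close> is
  everything, and a family of finite sets that is closed under non-empty subsets remains so after
  the point \<open>X\<close> joins the space.
\<close>

lemma openin_finite_hyperset_with_top_iff: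
  assumes "infinite X"
  shows "openin (subtopology (upper_semifinite X) (finite_hyperset X \<union> {X})) W
           \<longleftrightarrow> openin (finite_hyperspace X) W \<or> W = finite_hyperset X \<union> {X}"
proof -
  have "X \<noteq> {}"
    using assms by auto
  then have sub: "finite_hyperset X \<union> {X} \<subseteq> hyper_basic X"
    by (auto simp: hyper_basic_def finite_hyperset_def)
  have low: "hyper_basic C \<inter> (finite_hyperset X \<union> {X}) = hyper_basic C"
    if "C \<in> finite_hyperset X" for C
    using that by (auto simp: hyper_basic_def finite_hyperset_def intro: finite_subset)
  have top: "hyper_basic X \<inter> (finite_hyperset X \<union> {X}) = finite_hyperset X \<union> {X}"
    using sub by blast
  have notin: "X \<notin> finite_hyperset X"
    using assms by (simp add: finite_hyperset_def)
  show ?thesis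
  proof (cases "X \<in> W")
    case True
    then show ?thesis
      unfolding openin_subtopology_upper_semifinite_iff[OF sub] openin_finite_hyperspace_iff
      using top notin by blast
  next
    case False
    then have "W \<subseteq> finite_hyperset X \<union> {X} \<longleftrightarrow> W \<subseteq> finite_hyperset X"
      by blast
    with False show ?thesis
      unfolding openin_subtopology_upper_semifinite_iff[OF sub] openin_finite_hyperspace_iff
      using low by (metis UnI2 singletonI subset_iff)
  qed
qed

theorem proposition9:
  fixes X :: "'a set"
  assumes "infinite X"
  shows "homeomorphic_map
           (Alexandroff_compactification (finite_hyperspace X))
           (subtopology (upper_semifinite X) (finite_hyperset X \<union> {X}))
           (\<lambda>z. case z of None \<Rightarrow> X | Some C \<Rightarrow> C)"
    (is "homeomorphic_map ?A ?Y ?f")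
proof (rule bijective_open_imp_homeomorphic_map)
  have topA: "topspace ?A = insert None (Some ` finite_hyperset X)"
    by (simp add: topspace_finite_hyperspace)
  have topY: "topspace ?Y = finite_hyperset X \<union> {X}"
    using assms by (auto simp: topspace_upper_semifinite finite_hyperset_def)
  have notin: "X \<notin> finite_hyperset X"
    using assms by (simp add: finite_hyperset_def)
  show image: "?f ` topspace ?A = topspace ?Y"
    unfolding topA topY by (auto simp: image_image)
  show "inj_on ?f (topspace ?A)"
    unfolding topA using notin by (auto simp: inj_on_def)
  show "continuous_map ?A ?Y ?f"
    unfolding continuous_map_def
  proof (intro conjI allI impI)
    show "?f \<in> topspace ?A \<rightarrow> topspace ?Y"
      using image by blast
    fix W
    assume "openin ?Y W"
    then consider "openin (finite_hyperspace X) W" | "W = topspace ?Y"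
      unfolding openin_finite_hyperset_with_top_iff[OF assms] topY by blast
    then show "openin ?A {z \<in> topspace ?A. ?f z \<in> W}"
    proof cases
      case 1
      then have "W \<subseteq> finite_hyperset X"
        by (simp add: openin_finite_hyperspace_iff)
      then have "{z \<in> topspace ?A. ?f z \<in> W} = Some ` W"
        unfolding topA using notin by auto
      with 1 show ?thesis
        by (auto simp: openin_Alexandroff_compactification)
    next
      case 2
      then have "{z \<in> topspace ?A. ?f z \<in> W} = topspace ?A"
        using image by blast
      then show ?thesis
        by (simp only: openin_topspace)
    qed
  qed
  show "open_map ?A ?Y ?f"
    unfolding open_map_def
  proof (intro allI impI)
    fix U
    assume "openin ?A U"
    then consider V where "U = Some ` V" "openin (finite_hyperspace X) V"
      | K where "U = insert None (Some ` (topspace (finite_hyperspace X) - K))"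
          "compactin (finite_hyperspace X) K" "closedin (finite_hyperspace X) K"
      unfolding openin_Alexandroff_compactification by blast
    then show "openin ?Y (?f ` U)"
    proof cases
      case 1
      then have "?f ` U = V"
        by (simp add: image_image)
      with 1 show ?thesis
        unfolding openin_finite_hyperset_with_top_iff[OF assms] by simp
    next
      case 2
      then have "K = {}"
        using closed_compact_finite_hyperspace_empty[OF assms] by blast
      with 2 have "U = topspace ?A"
        by simp
      then show ?thesis
        using image openin_topspace by metis
    qed
  qed
qed

end
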